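(* There exists a planar graph that contains no cycle of length $4$ and no cycle of length $5$ (as subgraphs) and that is not $(3,2)$-choosable.
   Context: Graphs are finite and simple. A list assignment $L$ on a graph $G$ assigns to each vertex $v$ a set $L(v)$ of colors. An $L$-coloring of $G$ is a function $\varphi$ on $V(G)$ with $\varphi(v)\in L(v)$ for every vertex $v$ and $\varphi(x)\neq\varphi(y)$ for every edge $xy$. A graph $G$ is $(k,d)$-choosable if $G$ has an $L$-coloring for every list assignment $L$ such that $|L(v)|\ge k$ for every vertex $v$ and $|L(x)\cap L(y)|\le d$ for every edge $xy$ of $G$. *)

theory Defs
  imports "HOL-Analysis.Analysis" "Graph_Theory.Pair_Digraph"
begin

text \<open>
  A finite simple graph is a \<^locale>\<open>pair_graph\<close>: finitely many vertices and a symmetric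
  irreflexive set of pairs, the undirected edge \<open>uv\<close> being the two pairs \<open>(u,v)\<close> and \<open>(v,u)\<close>.
\<close>

text \<open>
  The curve of an edge is indexed by the unordered pair \<open>{u,v}\<close>, so that both orientations share
  one curve. Its own ends lie only at its endpoints because an \<^const>\<open>arc\<close> is injective.
\<close>

definition plane_drawing ::
    "'a pair_pre_digraph \<Rightarrow> ('a \<Rightarrow> complex) \<Rightarrow> ('a set \<Rightarrow> real \<Rightarrow> complex) \<Rightarrow> bool" where
  "plane_drawing G pos curve \<longleftrightarrow>
     inj_on pos (pverts G) \<and>
     (\<forall>(u,v) \<in> parcs G. arc (curve {u,v}) \<and>
        {pathstart (curve {u,v}), pathfinish (curve {u,v})} = {pos u, pos v}) \<and>
     (\<forall>(u,v) \<in> parcs G. \<forall>w \<in> pverts G - {u,v}. pos w \<notin> path_image (curve {u,v})) \<and>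
     (\<forall>(u,v) \<in> parcs G. \<forall>(x,y) \<in> parcs G. {u,v} \<noteq> {x,y} \<longrightarrow>
        path_image (curve {u,v}) \<inter> path_image (curve {x,y}) \<subseteq> pos ` ({u,v} \<inter> {x,y}))"

definition planar_graph :: "'a pair_pre_digraph \<Rightarrow> bool" where
  "planar_graph G \<longleftrightarrow> (\<exists>pos curve. plane_drawing G pos curve)"

text \<open>
  For lengths \<open>n \<ge> 3\<close>; the library's directed cycles also include \<open>u, v, u\<close>, of length 2.
\<close>

definition has_cycle_of_length :: "'a pair_pre_digraph \<Rightarrow> nat \<Rightarrow> bool" where
  "has_cycle_of_length G n \<longleftrightarrow> (\<exists>p. pre_digraph.cycle (with_proj G) p \<and> length p = n)"

definition list_coloring ::
    "'a pair_pre_digraph \<Rightarrow> ('a \<Rightarrow> 'c set) \<Rightarrow> ('a \<Rightarrow> 'c) \<Rightarrow> bool" where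
  "list_coloring G L \<phi> \<longleftrightarrow>
     (\<forall>v \<in> pverts G. \<phi> v \<in> L v) \<and> (\<forall>(x,y) \<in> parcs G. \<phi> x \<noteq> \<phi> y)"

text \<open>
  Lists are finite, so \<^const>\<open>card\<close> is the true cardinality. Colors are natural numbers without
  loss of generality: a finite graph with finite lists uses only finitely many colors.
\<close>

definition choosable :: "nat \<Rightarrow> nat \<Rightarrow> 'a pair_pre_digraph \<Rightarrow> bool" where
  "choosable k d G \<longleftrightarrow>
     (\<forall>L :: 'a \<Rightarrow> nat set.
        (\<forall>v \<in> pverts G. finite (L v) \<and> k \<le> card (L v)) \<and>
        (\<forall>(x,y) \<in> parcs G. card (L x \<inter> L y) \<le> d)
        \<longrightarrow> (\<exists>\<phi>. list_coloring G L \<phi>))"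

end

theory Submission
  imports Defs
begin

text \<open>
  The colors of two vertices, the hubs, can be any of nine pairs, and each pair is refuted by its
  own copy of one gadget. The gadget is a plane graph on 25 vertices and two hubs. It has no cycle
  of length 4 or 5, its hubs lie on a common face and are neither adjacent nor joined by a path of
  length 2, and it comes with lists from which it cannot be colored once the hubs have received two
  prescribed colors (\<open>gadget_uncolorable\<close>). Give the hubs disjoint lists of three colors, and for each
  of the nine pairs attach to the same two hubs a private copy of the gadget in which that pair
  plays the role of the prescribed colors. Whatever a coloring does on the hubs, it fails in the
  copy of that pair (\<open>glued_uncolorable\<close>). Adjacent lists in the gadget are never equal, so they
  share at most two colors.

  Gluing creates no short cycle. A cycle that enters two copies passes through both hubs, so it
  consists of two paths of length at least 3; any other cycle projects to a cycle of the gadget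
  (\<open>glued_no_4\<close>, \<open>glued_no_5\<close>).

  Gluing keeps planarity because both hubs are on the outer face, and this is made explicit by a
  straight-line drawing. Send one hub to infinity in the horizontal and the other in the vertical
  direction, so that the edges to the hubs become rays to the right and rays upwards. The squares
  that hold the rest of the copies are then placed one after the other along the diagonal, where no
  ray of one copy meets another copy (\<open>copies_apart\<close>). A projective map carries the picture back
  to the finite plane and preserves lines. Within one copy, disjointness of the edges is a finite
  check of signs of integer determinants (\<open>gadget_star\<close>, \<open>gadget_edges_apart\<close>).
\<close>

section \<open>The gadget\<close>

text \<open>
  The vertices 25 and 26 are the hubs; the others become private to each copy.
\<close>

definition gadget_nbrs :: "nat list list" where
  "gadget_nbrs =
    [[1, 3, 26], [0, 2, 3], [1, 4, 7, 12], [0, 1, 25], [2, 5, 6], [4, 6, 9], [4, 5, 25],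
     [2, 8, 12], [7, 9, 10], [5, 8, 10], [8, 9, 11], [10, 13, 14, 15, 25], [2, 7, 14, 16],
     [11, 21, 25], [11, 12, 16], [11, 17, 19], [12, 14, 26], [15, 18, 19], [17, 20, 21],
     [15, 17, 26], [18, 21, 22], [13, 18, 20], [20, 23, 24], [22, 24, 25], [22, 23, 26],
     [3, 6, 11, 13, 23], [0, 16, 19, 24]]"

definition gadget :: "nat rel" where
  "gadget = {(i, j). i < 27 \<and> j \<in> set (gadget_nbrs ! i)}"

text \<open>
  The colors 18 and 19 stand for the prescribed colors of the hubs and are replaced in each copy;
  the colors below 18 are common to all copies.
\<close>

definition gadget_list :: "nat \<Rightarrow> nat list" where
  "gadget_list i =
    [[0, 1, 19], [0, 1, 2], [0, 2, 3], [0, 1, 18], [0, 3, 4], [0, 4, 5], [0, 4, 18],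
     [0, 3, 6], [3, 6, 7], [5, 3, 7], [3, 7, 8], [3, 8, 18], [0, 3, 9],
     [3, 10, 18], [3, 8, 9], [3, 11, 12], [3, 9, 19], [11, 12, 13], [11, 13, 14],
     [11, 12, 19], [11, 14, 15], [10, 11, 14], [15, 16, 17], [16, 17, 18], [16, 17, 19],
     [18], [19]] ! i"

text \<open>
  The forcing device is a triangle in which outside neighbors leave two vertices with the same two
  colors: these two use up both colors, so the third vertex has to avoid them. Triangle 0, 1, 3
  fixes the color of 1 and leaves vertex 2 with the colors 0 and 3. If 2 gets 0, the triangle
  12, 14, 16 fixes the color of 14. If 2 gets 3, the triangle 4, 5, 6 fixes the color of 5, and since
  7 and 12 cannot both get 0, either the triangle 8, 9, 10 or again 12, 14, 16 acts. In every case 11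
  is left with the color 3, and from 11 on everything is forced up to the triangle 22, 23, 24, for
  which only the colors 16 and 17 remain.
\<close>

lemma gadget_uncolorable:
  assumes L: "\<And>i. i < 27 \<Longrightarrow> g i \<in> set (gadget_list i)"
    and ne: "\<And>i j. (i, j) \<in> gadget \<Longrightarrow> g i \<noteq> g j"
  shows False
proof -
  note table = gadget_def gadget_nbrs_def gadget_list_def
  have hub: "g 25 = 18" "g 26 = 19"
    using L[of 25] L[of 26] by (simp_all add: table)
  have "g 1 = 2"
    using hub L[of 0] L[of 1] L[of 3]
      ne[of 0 1] ne[of 0 3] ne[of 1 3] ne[of 0 26] ne[of 3 25]
    by (auto simp: table)
  then have "g 2 = 0 \<or> g 2 = 3"
    using L[of 2]
      ne[of 1 2]
    by (auto simp: table)
  then have "g 11 = 3"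
  proof
    assume "g 2 = 0"
    then have "g 12 = 3 \<or> g 12 = 9"
      using L[of 12]
      ne[of 2 12]
      by (auto simp: table)
    then have "g 14 = 8"
      using hub L[of 12] L[of 14] L[of 16]
      ne[of 12 14] ne[of 12 16] ne[of 14 16] ne[of 16 26]
      by (auto simp: table)
    then show ?thesis
      using hub L[of 11]
      ne[of 11 14] ne[of 11 25]
      by (auto simp: table)
  next
    assume 2: "g 2 = 3"
    then have 5: "g 5 = 5"
      using hub L[of 4] L[of 5] L[of 6]
      ne[of 2 4] ne[of 4 5] ne[of 4 6] ne[of 5 6] ne[of 6 25]
      by (auto simp: table)
    have "g 7 = 6 \<or> g 12 = 9"
      using 2 L[of 7] L[of 12]
      ne[of 2 7] ne[of 2 12] ne[of 7 12]
      by (auto simp: table)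
    then show ?thesis
    proof
      assume "g 7 = 6"
      then have "g 10 = 8"
        using 5 L[of 8] L[of 9] L[of 10]
      ne[of 7 8] ne[of 5 9] ne[of 8 9] ne[of 8 10] ne[of 9 10]
        by (auto simp: table)
      then show ?thesis
        using hub L[of 11]
      ne[of 10 11] ne[of 11 25]
        by (auto simp: table)
    next
      assume "g 12 = 9"
      then have "g 14 = 8"
        using hub L[of 14] L[of 16]
      ne[of 12 14] ne[of 12 16] ne[of 14 16] ne[of 16 26]
        by (auto simp: table)
      then show ?thesis
        using hub L[of 11]
      ne[of 11 14] ne[of 11 25]
        by (auto simp: table)
    qed
  qed
  then have 17: "g 17 = 13" and 13: "g 13 = 10"
    using hub L[of 13] L[of 15] L[of 17] L[of 19]
      ne[of 11 13] ne[of 13 25] ne[of 11 15] ne[of 15 17] ne[of 15 19] ne[of 17 19] ne[of 19 26]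
    by (auto simp: table)
  then have "g 20 = 15"
    using L[of 18] L[of 20] L[of 21]
      ne[of 17 18] ne[of 13 21] ne[of 18 20] ne[of 18 21] ne[of 20 21]
    by (auto simp: table)
  then show False
    using hub L[of 22] L[of 23] L[of 24]
      ne[of 20 22] ne[of 22 23] ne[of 22 24] ne[of 23 24] ne[of 23 25] ne[of 24 26]
    by (auto simp: table)
qed

lemma gadget_all:
  assumes "\<forall>i\<in>set [0..<27]. \<forall>j\<in>set (gadget_nbrs ! i). P i j" "(i, j) \<in> gadget"
  shows "P i j"
  using assms by (auto simp: gadget_def)

lemma gadget_less:
  assumes "(i, j) \<in> gadget"
  shows "i < 27" "j < 27"
proof -
  have "\<forall>i\<in>set [0..<27]. \<forall>j\<in>set (gadget_nbrs ! i). i < 27 \<and> j < 27"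
    by code_simp
  from gadget_all[OF this assms] show "i < 27" "j < 27" by simp_all
qed

lemma gadget_sym:
  assumes "(i, j) \<in> gadget"
  shows "(j, i) \<in> gadget"
proof -
  have "\<forall>i\<in>set [0..<27]. \<forall>j\<in>set (gadget_nbrs ! i). i \<in> set (gadget_nbrs ! j)"
    by code_simp
  from gadget_all[OF this assms] show ?thesis
    using gadget_less[OF assms] by (simp add: gadget_def)
qed

lemma gadget_arc:
  assumes "(i, j) \<in> gadget"
  shows "i \<noteq> j" "i < 25 \<or> j < 25"
proof -
  have "\<forall>i\<in>set [0..<27]. \<forall>j\<in>set (gadget_nbrs ! i). i \<noteq> j \<and> (i < 25 \<or> j < 25)"
    by code_simp
  from gadget_all[OF this assms] show "i \<noteq> j" "i < 25 \<or> j < 25" by simp_all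
qed

lemma gadget_4:
  assumes "(a, b) \<in> gadget" "(b, c) \<in> gadget" "(c, d) \<in> gadget" "(d, a) \<in> gadget"
  shows "a = c \<or> b = d"
proof -
  have "\<forall>a\<in>set [0..<27]. \<forall>b\<in>set (gadget_nbrs ! a). \<forall>c\<in>set (gadget_nbrs ! b).
      \<forall>d\<in>set (gadget_nbrs ! c).
        a \<in> set (gadget_nbrs ! d) \<longrightarrow> a = c \<or> b = d"
    by code_simp
  moreover have "a \<in> set [0..<27]" "b \<in> set (gadget_nbrs ! a)" "c \<in> set (gadget_nbrs ! b)"
      "d \<in> set (gadget_nbrs ! c)" "a \<in> set (gadget_nbrs ! d)"
    using assms by (auto simp: gadget_def)
  ultimately show ?thesis by blast
qed

lemma gadget_5:
  assumes "(a, b) \<in> gadget" "(b, c) \<in> gadget" "(c, d) \<in> gadget" "(d, e) \<in> gadget" "(e, a) \<in> gadget"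
  shows "a = c \<or> b = d \<or> c = e \<or> d = a \<or> e = b"
proof -
  have "\<forall>a\<in>set [0..<27]. \<forall>b\<in>set (gadget_nbrs ! a). \<forall>c\<in>set (gadget_nbrs ! b).
      \<forall>d\<in>set (gadget_nbrs ! c).
      \<forall>e\<in>set (gadget_nbrs ! d). a \<in> set (gadget_nbrs ! e) \<longrightarrow> a = c \<or> b = d \<or> c = e \<or> d = a \<or> e = b"
    by code_simp
  moreover have "a \<in> set [0..<27]" "b \<in> set (gadget_nbrs ! a)" "c \<in> set (gadget_nbrs ! b)"
      "d \<in> set (gadget_nbrs ! c)" "e \<in> set (gadget_nbrs ! d)" "a \<in> set (gadget_nbrs ! e)"
    using assms by (auto simp: gadget_def)
  ultimately show ?thesis by blast
qed

text \<open>
  Together with \<open>gadget_arc\<close>, this puts the hubs at distance at least 3, which is what makes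
  cycles through two copies long.
\<close>

lemma gadget_hubs_no_common: "(25, i) \<in> gadget \<Longrightarrow> (i, 26) \<notin> gadget"
proof
  assume "(25, i) \<in> gadget" "(i, 26) \<in> gadget"
  then have "i \<in> set (gadget_nbrs ! 25)" "26 \<in> set (gadget_nbrs ! i)" by (auto simp: gadget_def)
  moreover have "\<forall>i\<in>set (gadget_nbrs ! 25). 26 \<notin> set (gadget_nbrs ! i)" by code_simp
  ultimately show False by blast
qed

section \<open>Nine copies sharing the hubs\<close>

text \<open>
  The hubs 25 and 26 become 225 and 226 in every copy, so that all copies share them.
\<close>

definition copy_vertex :: "nat \<Rightarrow> nat \<Rightarrow> nat" where
  "copy_vertex k i = (if i < 25 then 25 * k + i else 200 + i)"

definition local_index :: "nat \<Rightarrow> nat" where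
  "local_index x = (if x < 225 then x mod 25 else x - 200)"

definition glued :: "nat pair_pre_digraph" where
  "glued = \<lparr>pverts = {..<227},
     parcs = {(copy_vertex k i, copy_vertex k j) | k i j. k < 9 \<and> (i, j) \<in> gadget}\<rparr>"

lemma glued_arcE:
  assumes "(x, y) \<in> parcs glued"
  obtains k i j where "k < 9" "(i, j) \<in> gadget" "x = copy_vertex k i" "y = copy_vertex k j"
  using assms by (auto simp: glued_def)

lemma glued_arcI: "k < 9 \<Longrightarrow> (i, j) \<in> gadget \<Longrightarrow> (copy_vertex k i, copy_vertex k j) \<in> parcs glued"
  by (auto simp: glued_def)

lemma local_index_copy_vertex: "k < 9 \<Longrightarrow> local_index (copy_vertex k i) = i"
  by (auto simp: local_index_def copy_vertex_def)

lemma copy_vertex_less: "k < 9 \<Longrightarrow> i < 27 \<Longrightarrow> copy_vertex k i < 227"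
  by (auto simp: copy_vertex_def)

lemma copy_vertex_eq_iff:
  assumes "k < 9" "k' < 9"
  shows "copy_vertex k i = copy_vertex k' j \<longleftrightarrow> i = j \<and> (i < 25 \<longrightarrow> k = k')"
proof
  assume eq: "copy_vertex k i = copy_vertex k' j"
  then have "i = j"
    using local_index_copy_vertex[OF assms(1), of i] local_index_copy_vertex[OF assms(2), of j] by simp
  with eq show "i = j \<and> (i < 25 \<longrightarrow> k = k')"
    by (simp add: copy_vertex_def split: if_splits)
qed (auto simp: copy_vertex_def)

lemma copy_vertex_local_index:
  "x < 225 \<Longrightarrow> copy_vertex (x div 25) (local_index x) = x"
  "225 \<le> x \<Longrightarrow> copy_vertex k (local_index x) = x"
  by (auto simp: copy_vertex_def local_index_def)

lemma glued_sym: "(x, y) \<in> parcs glued \<Longrightarrow> (y, x) \<in> parcs glued"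
  by (auto simp: glued_def dest: gadget_sym)

lemma glued_pair_graph: "pair_graph glued"
proof unfold_locales
  fix e assume e: "e \<in> parcs glued"
  then obtain k i j where "k < 9" "(i, j) \<in> gadget" "e = (copy_vertex k i, copy_vertex k j)"
    by (cases e) (auto elim: glued_arcE)
  then show "fst e \<in> pverts glued" "snd e \<in> pverts glued" "fst e \<noteq> snd e"
    using gadget_less[of i j] gadget_arc[of i j] by (auto simp: glued_def copy_vertex_less copy_vertex_eq_iff)
next
  show "finite (pverts glued)" by (simp add: glued_def)
  have "parcs glued \<subseteq> {..<227} \<times> {..<227}"
    by (auto simp: glued_def copy_vertex_less gadget_less)
  then show "finite (parcs glued)" by (rule finite_subset) simp
next
  show "symmetric (with_proj glued)"
    by (auto simp: symmetric_def sym_def glued_sym)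
qed

lemma glued_local_index: "(x, y) \<in> parcs glued \<Longrightarrow> (local_index x, local_index y) \<in> gadget"
  by (auto elim!: glued_arcE simp: local_index_copy_vertex)

lemma glued_copy: "(x, y) \<in> parcs glued \<Longrightarrow> x < 225 \<Longrightarrow> y < 225 \<Longrightarrow> x div 25 = y div 25"
  by (auto elim!: glued_arcE simp: copy_vertex_def split: if_splits)

lemma glued_less: "(x, y) \<in> parcs glued \<Longrightarrow> x < 227" "(x, y) \<in> parcs glued \<Longrightarrow> y < 227"
  by (auto elim!: glued_arcE simp: copy_vertex_less gadget_less)+

lemma local_index_hub: "local_index x = 25 \<longleftrightarrow> x = 225" "local_index x = 26 \<longleftrightarrow> x = 226"
    "local_index x < 25 \<longleftrightarrow> x < 225"
proof -
  have "x mod 25 < 25" by simp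
  then show "local_index x = 25 \<longleftrightarrow> x = 225" "local_index x = 26 \<longleftrightarrow> x = 226"
    "local_index x < 25 \<longleftrightarrow> x < 225"
    unfolding local_index_def by (auto simp del: mod_less_divisor)
qed

section \<open>Absence of cycles of length 4 and 5\<close>

text \<open>
  A common neighbor of the two hubs would be one in a single copy.
\<close>

lemma glued_one_hub:
  assumes "(x, y) \<in> parcs glued" "(x, z) \<in> parcs glued" "\<not> y < 225" "\<not> z < 225"
  shows "y = z"
proof (rule ccontr)
  assume "y \<noteq> z"
  then have "(y = 225 \<and> z = 226) \<or> (y = 226 \<and> z = 225)"
    using assms glued_less[of x y] glued_less[of x z] by linarith
  then show False
    using gadget_hubs_no_common[of "local_index x"] glued_local_index[OF assms(1)]
      glued_local_index[OF assms(2)]      gadget_sym[of "local_index x" 25] by (auto simp: local_index_def)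
qed

lemma glued_hub_nbr: "(x, y) \<in> parcs glued \<Longrightarrow> 225 \<le> y \<Longrightarrow> x < 225"
  using gadget_arc(2)[OF glued_local_index, of x y] local_index_hub(3)[of x] local_index_hub(3)[of y]
  by simp

lemma local_index_inj:
  assumes "local_index x = local_index y" "x < 227" "y < 227" "x < 225 \<Longrightarrow> y < 225 \<Longrightarrow> x div 25 = y div 25"
  shows "x = y"
proof (cases "x < 225")
  case True
  then have y: "y < 225" using assms(1) local_index_hub(3)[of x] local_index_hub(3)[of y] by simp
  have "x = copy_vertex (x div 25) (local_index x)" using copy_vertex_local_index(1)[OF True] ..
  also have "\<dots> = copy_vertex (y div 25) (local_index y)" by (simp only: assms(1) assms(4)[OF True y])
  also have "\<dots> = y" by (rule copy_vertex_local_index(1)[OF y])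
  finally show ?thesis .
next
  case False
  then have "\<not> y < 225" using assms(1) local_index_hub(3)[of x] local_index_hub(3)[of y] by simp
  then have "local_index y = y - 200" by (simp add: local_index_def)
  moreover have "local_index x = x - 200" using False by (simp add: local_index_def)
  ultimately show ?thesis using False \<open>\<not> y < 225\<close> assms(1) by linarith
qed

text \<open>
  A path that passes through no hub stays in one copy, and there the local index determines the
  vertex. A short path is therefore projected to the gadget without identifying its ends.
\<close>

lemma local_index_inj_path2:
  assumes arcs: "(a, b) \<in> parcs glued" "(b, c) \<in> parcs glued" and "local_index a = local_index c" "b < 225"
  shows "a = c"
proof (rule local_index_inj)
  show "a < 227" "c < 227" using arcs by (simp_all add: glued_less)
  show "a div 25 = c div 25" if "a < 225" "c < 225"
    using glued_copy[OF arcs(1)] glued_copy[OF arcs(2)] that \<open>b < 225\<close> by (simp only:)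
qed fact

lemma local_index_inj_path3:
  assumes arcs: "(a, b) \<in> parcs glued" "(b, c) \<in> parcs glued" "(c, d) \<in> parcs glued"
    and "local_index a = local_index d" "b < 225" "c < 225"
  shows "a = d"
proof (rule local_index_inj)
  show "a < 227" "d < 227" using arcs by (simp_all add: glued_less)
  show "a div 25 = d div 25" if "a < 225" "d < 225"
    using glued_copy[OF arcs(1)] glued_copy[OF arcs(2)] glued_copy[OF arcs(3)] that
      \<open>b < 225\<close> \<open>c < 225\<close> by (simp only:)
qed fact

lemma cycle_4E:
  assumes "has_cycle_of_length G 4"
  obtains a b c d where "(a, b) \<in> parcs G" "(b, c) \<in> parcs G" "(c, d) \<in> parcs G" "(d, a) \<in> parcs G"
    "distinct [a, b, c, d]"
proof -
  interpret pair_pre_digraph G .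
  from assms obtain p u where p: "awalk u p u" "distinct (tl (pawalk_verts u p))" "length p = 4"
    by (auto simp: has_cycle_of_length_def cycle_def)
  then obtain a1 b1 a2 b2 a3 b3 a4 b4 where "p = [(a1, b1), (a2, b2), (a3, b3), (a4, b4)]"
    by (auto simp: length_Suc_conv numeral_eq_Suc)
  with p show thesis
    by (intro that[of a1 a2 a3 a4]) (auto simp: awalk_def)
qed

lemma cycle_5E:
  assumes "has_cycle_of_length G 5"
  obtains a b c d e where "(a, b) \<in> parcs G" "(b, c) \<in> parcs G" "(c, d) \<in> parcs G" "(d, e) \<in> parcs G" "(e, a) \<in> parcs G"
    "distinct [a, b, c, d, e]"
proof -
  interpret pair_pre_digraph G .
  from assms obtain p u where p: "awalk u p u" "distinct (tl (pawalk_verts u p))" "length p = 5"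
    by (auto simp: has_cycle_of_length_def cycle_def)
  then obtain a1 b1 a2 b2 a3 b3 a4 b4 a5 b5 where
      "p = [(a1, b1), (a2, b2), (a3, b3), (a4, b4), (a5, b5)]"
    by (auto simp: length_Suc_conv numeral_eq_Suc)
  with p show thesis
    by (intro that[of a1 a2 a3 a4 a5]) (auto simp: awalk_def)
qed

text \<open>
  The cycle projects to a closed walk in the gadget, and only vertices that are not adjacent could
  be identified. Two opposite vertices are joined by two paths of length 2 whose middle vertices
  are not both hubs, so one of the paths keeps their local indices apart.
\<close>

lemma glued_no_4: "\<not> has_cycle_of_length glued 4"
proof
  assume "has_cycle_of_length glued 4"
  then obtain a b c d where e: "(a, b) \<in> parcs glued" "(b, c) \<in> parcs glued"
      "(c, d) \<in> parcs glued" "(d, a) \<in> parcs glued"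
    and dist: "distinct [a, b, c, d]" by (rule cycle_4E)
  have opp: "local_index a \<noteq> local_index c" if e: "(a, b) \<in> parcs glued" "(b, c) \<in> parcs glued"
      "(c, d) \<in> parcs glued" "(d, a) \<in> parcs glued"
    and "distinct [a, b, c, d]" for a b c d
  proof -
    have "b < 225 \<or> d < 225"
      using glued_one_hub[OF e(1) glued_sym[OF e(4)]] that(5) by auto
    then show ?thesis
      using local_index_inj_path2[of a b c] local_index_inj_path2[of c d a] that by auto
  qed
  have "local_index a \<noteq> local_index c" "local_index b \<noteq> local_index d"
    using opp[of a b c d] opp[of b c d a] e dist by auto
  then show False
    using gadget_4[OF e[THEN glued_local_index]] by blast
qed

text \<open>
  Two vertices that are not adjacent on the cycle are joined by a path of length 2 and one of length 3.
  If the middle vertex of the first is a hub, the second contains no hub, because the two vertices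
  cannot see both hubs.
\<close>

lemma glued_no_5: "\<not> has_cycle_of_length glued 5"
proof
  assume "has_cycle_of_length glued 5"
  then obtain a b c d e where e: "(a, b) \<in> parcs glued" "(b, c) \<in> parcs glued"
      "(c, d) \<in> parcs glued" "(d, e) \<in> parcs glued" "(e, a) \<in> parcs glued"
    and dist: "distinct [a, b, c, d, e]" by (rule cycle_5E)
  have opp: "local_index a \<noteq> local_index c" if arcs: "(a, b) \<in> parcs glued" "(b, c) \<in> parcs glued"
      "(c, d) \<in> parcs glued" "(d, e) \<in> parcs glued" "(e, a) \<in> parcs glued"
    and dist: "distinct [a, b, c, d, e]" for a b c d e
  proof (cases "b < 225")
    case True
    then show ?thesis using local_index_inj_path2[of a b c] arcs dist by auto
  next
    case False
    then have "d < 225" "e < 225"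
      using glued_one_hub[OF glued_sym[OF arcs(2)] arcs(3)] glued_one_hub[OF arcs(1) glued_sym[OF arcs(5)]]
        dist by auto
    then show ?thesis using local_index_inj_path3[of c d e a] arcs dist by auto
  qed
  have "local_index a \<noteq> local_index c" "local_index b \<noteq> local_index d"
      "local_index c \<noteq> local_index e" "local_index d \<noteq> local_index a" "local_index e \<noteq> local_index b"
    using opp[of a b c d e] opp[of b c d e a] opp[of c d e a b]
      opp[of d e a b c] opp[of e a b c d] e dist by auto
  then show False
    using gadget_5[OF e[THEN glued_local_index]] by blast
qed

section \<open>Lists\<close>

text \<open>
  Copy \<open>k\<close> is responsible for the \<open>k div 3\<close>-th color of the first hub and the \<open>k mod 3\<close>-th color
  of the second, counted from 0.
\<close>

definition recolor :: "nat \<Rightarrow> nat \<Rightarrow> nat" where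
  "recolor k c = (if c < 18 then c else if c = 18 then 18 + k div 3 else 21 + k mod 3)"

definition glued_list :: "nat \<Rightarrow> nat set" where
  "glued_list x =
    (if x = 225 then {18, 19, 20} else if x = 226 then {21, 22, 23}
     else recolor (x div 25) ` set (gadget_list (x mod 25)))"

lemma gadget_list_props:
  assumes "i < 25"
  shows "distinct (gadget_list i)" "length (gadget_list i) = 3" "set (gadget_list i) \<subseteq> {..<20}"
    "\<exists>c\<in>set (gadget_list i). c < 18"
proof -
  have "\<forall>i\<in>set [0..<25]. distinct (gadget_list i) \<and> length (gadget_list i) = 3 \<and>
      (\<forall>c\<in>set (gadget_list i). c < 20) \<and> (\<exists>c\<in>set (gadget_list i). c < 18)"
    by code_simp
  then show "distinct (gadget_list i)" "length (gadget_list i) = 3" "set (gadget_list i) \<subseteq> {..<20}"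
    "\<exists>c\<in>set (gadget_list i). c < 18"
    using assms by auto
qed

lemma gadget_list_separated:
  assumes "(i, j) \<in> gadget" "i < 25" "j < 25"
  shows "\<exists>c\<in>set (gadget_list i). c \<notin> set (gadget_list j)"
proof -
  have "\<forall>i\<in>set [0..<27]. \<forall>j\<in>set (gadget_nbrs ! i).
      i < 25 \<longrightarrow> j < 25 \<longrightarrow> (\<exists>c\<in>set (gadget_list i). c \<notin> set (gadget_list j))"
    by code_simp
  from gadget_all[OF this assms(1)] assms(2,3) show ?thesis by blast
qed

lemma recolor_inj:
  assumes "k < 9"
  shows "inj_on (recolor k) {..<20}"
proof (rule inj_onI)
  fix c d assume "c \<in> {..<20}" "d \<in> {..<20}" "recolor k c = recolor k d"
  moreover have "k div 3 < 3" using assms by simp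
  ultimately show "c = d"
    by (auto simp: recolor_def split: if_splits)
qed

lemma glued_list_copy_vertex:
  "k < 9 \<Longrightarrow> i < 25 \<Longrightarrow> glued_list (copy_vertex k i) = recolor k ` set (gadget_list i)"
  by (simp add: glued_list_def copy_vertex_def)

lemma card_glued_list:
  assumes "x < 227"
  shows "finite (glued_list x) \<and> card (glued_list x) = 3"
proof (cases "x < 225")
  case True
  have "x mod 25 < 25" by simp
  note props = gadget_list_props[OF this]
  have "card (glued_list x) = card (set (gadget_list (x mod 25)))"
    using True inj_on_subset[OF recolor_inj props(3), of "x div 25"] by (simp add: glued_list_def card_image)
  also have "\<dots> = 3"
    using props(1,2) by (simp add: distinct_card)
  finally show ?thesis using True by (simp add: glued_list_def)
next
  case False
  then have "x = 225 \<or> x = 226" using assms by linarith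
  then show ?thesis by (auto simp: glued_list_def)
qed

lemma card_Int_less:
  assumes "finite A" "c \<in> A" "c \<notin> B"
  shows "card (A \<inter> B) < card A"
  using assms by (intro psubset_card_mono) auto

lemma glued_list_separated_inner:
  assumes "(x, y) \<in> parcs glued" "x < 225"
  shows "card (glued_list x \<inter> glued_list y) \<le> 2"
proof -
  obtain k i j where k: "k < 9" and ij: "(i, j) \<in> gadget"
    and x: "x = copy_vertex k i" and y: "y = copy_vertex k j"
    using assms(1) by (rule glued_arcE)
  have i: "i < 25" and j: "j < 27"
    using assms(2) x gadget_less[OF ij] by (auto simp: copy_vertex_def split: if_splits)
  have "\<exists>c\<in>glued_list x. c \<notin> glued_list y"
  proof (cases "j < 25")
    case True
    then obtain c where c: "c \<in> set (gadget_list i)" "c \<notin> set (gadget_list j)"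
      using gadget_list_separated[OF ij i] by blast
    then have "recolor k c \<notin> recolor k ` set (gadget_list j)"
      using gadget_list_props(3)[OF i] gadget_list_props(3)[OF True]
      by (subst inj_on_image_mem_iff[OF recolor_inj[OF k]]) auto
    then show ?thesis
      using c k i True by (auto simp: x y glued_list_copy_vertex)
  next
    case False
    then have "y = 225 \<or> y = 226" using j y by (auto simp: copy_vertex_def)
    \<comment> \<open>Hub lists start at 18, so any color common to all copies separates.\<close>
    moreover obtain c where "c \<in> set (gadget_list i)" "c < 18"
      using gadget_list_props(4)[OF i] by blast
    moreover from this have "c \<in> glued_list x"
      using k i by (auto simp: x glued_list_copy_vertex recolor_def intro!: image_eqI[of _ _ c])
    ultimately show ?thesis by (intro bexI[of _ c]) (auto simp: glued_list_def)
  qed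
  then obtain c where "c \<in> glued_list x" "c \<notin> glued_list y" ..
  then have "card (glued_list x \<inter> glued_list y) < card (glued_list x)"
    using card_glued_list[of x] assms(2) by (intro card_Int_less) auto
  then show ?thesis using card_glued_list[of x] assms(2) by simp
qed

lemma glued_list_separated:
  assumes "(x, y) \<in> parcs glued"
  shows "card (glued_list x \<inter> glued_list y) \<le> 2"
proof (cases "x < 225")
  case True
  with assms show ?thesis by (rule glued_list_separated_inner)
next
  case False
  then have "y < 225" using glued_hub_nbr[OF glued_sym[OF assms]] by simp
  from glued_list_separated_inner[OF glued_sym[OF assms] this] show ?thesis
    by (simp add: Int_commute)
qed

text \<open>
  The colors of the hubs select a copy, and undoing its recoloring there produces a coloring that
  \<open>gadget_uncolorable\<close> excludes.
\<close>

lemma glued_uncolorable: "\<not> list_coloring glued glued_list \<phi>"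
proof
  assume col: "list_coloring glued glued_list \<phi>"
  have mem: "\<phi> x \<in> glued_list x" if "x < 227" for x
    using col that by (simp add: list_coloring_def glued_def)
  have ne: "\<phi> x \<noteq> \<phi> y" if "(x, y) \<in> parcs glued" for x y
    using col that by (auto simp: list_coloring_def)
  obtain a where a: "a < 3" "\<phi> 225 = 18 + a"
    using mem[of 225] by (auto simp: glued_list_def)
  obtain b where b: "b < 3" "\<phi> 226 = 21 + b"
    using mem[of 226] by (auto simp: glued_list_def)
  define k where "k = 3 * a + b"
  have k: "k < 9" "k div 3 = a" "k mod 3 = b"
    using a b by (auto simp: k_def)
  have "\<exists>c\<in>set (gadget_list i). \<phi> (copy_vertex k i) = recolor k c" if "i < 27" for i
  proof (cases "i < 25")
    case True
    then show ?thesis using mem[of "copy_vertex k i"] k(1) by (auto simp: glued_list_copy_vertex copy_vertex_less)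
  next
    case False
    then have "i = 25 \<or> i = 26" using that by linarith
    then show ?thesis
      using a b k by (auto simp: copy_vertex_def recolor_def gadget_list_def)
  qed
  then obtain g where g:
      "\<And>i. i < 27 \<Longrightarrow> g i \<in> set (gadget_list i) \<and> \<phi> (copy_vertex k i) = recolor k (g i)"
    by metis
  show False
  proof (rule gadget_uncolorable[of g])
    show "g i \<in> set (gadget_list i)" if "i < 27" for i using g that by blast
    show "g i \<noteq> g j" if "(i, j) \<in> gadget" for i j
      using ne[OF glued_arcI[OF k(1) that]] g gadget_less[OF that] by metis
  qed
qed

lemma glued_not_choosable: "\<not> choosable 3 2 glued"
proof
  assume "choosable 3 2 glued"
  moreover have "\<forall>v\<in>pverts glued. finite (glued_list v) \<and> 3 \<le> card (glued_list v)"
    using card_glued_list by (simp add: glued_def)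
  moreover have "\<forall>(x, y)\<in>parcs glued. card (glued_list x \<inter> glued_list y) \<le> 2"
    using glued_list_separated by auto
  ultimately show False
    unfolding choosable_def using glued_uncolorable by blast
qed

section \<open>Straight-line drawings in homogeneous coordinates\<close>

text \<open>
  That an edge avoids every vertex other than its ends follows from the condition on pairs of
  edges: a vertex on a foreign edge would make an edge at this vertex meet the foreign edge in
  a point that is not a common end.
\<close>

lemma planar_graph_straight_line:
  fixes G :: "'a::linorder pair_pre_digraph" and pos :: "'a \<Rightarrow> complex"
  assumes G: "pair_graph G" and inj: "inj_on pos (pverts G)"
    and nbr: "\<And>w. w \<in> pverts G \<Longrightarrow> \<exists>z. (w, z) \<in> parcs G"
    and meet: "\<And>u v x y. (u, v) \<in> parcs G \<Longrightarrow> (x, y) \<in> parcs G \<Longrightarrow> {u, v} \<noteq> {x, y} \<Longrightarrow>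
      closed_segment (pos u) (pos v) \<inter> closed_segment (pos x) (pos y) \<subseteq> pos ` ({u, v} \<inter> {x, y})"
  shows "planar_graph G"
proof -
  interpret P: pair_graph G by (rule G)
  define curve where "curve S = linepath (pos (Min S)) (pos (Max S))" for S :: "'a set"
  have ends: "{pos (Min {u, v}), pos (Max {u, v})} = {pos u, pos v}" for u v
    by (auto simp: min_def max_def)
  have img: "path_image (curve {u, v}) = closed_segment (pos u) (pos v)" for u v
    by (auto simp: curve_def min_def max_def closed_segment_commute)
  have arcs: "arc (curve {u, v})"
      "{pathstart (curve {u, v}), pathfinish (curve {u, v})} = {pos u, pos v}"
    if uv: "(u, v) \<in> parcs G" for u v
  proof -
    have "pos u \<noteq> pos v"
      using inj P.in_arcsD1[OF uv] P.in_arcsD2[OF uv] P.pair_no_loops[OF uv] by (auto simp: inj_on_def)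
    then have "pos (Min {u, v}) \<noteq> pos (Max {u, v})"
      by (auto simp: min_def max_def)
    then show "arc (curve {u, v})"
      "{pathstart (curve {u, v}), pathfinish (curve {u, v})} = {pos u, pos v}"
      using ends[of u v] unfolding curve_def by (simp_all add: arc_linepath)
  qed
  have avoid: "pos w \<notin> path_image (curve {u, v})"
    if uv: "(u, v) \<in> parcs G" and w: "w \<in> pverts G - {u, v}" for u v w
  proof
    assume "pos w \<in> path_image (curve {u, v})"
    moreover obtain z where wz: "(w, z) \<in> parcs G" using nbr w by blast
    ultimately have "pos w \<in> closed_segment (pos u) (pos v) \<inter> closed_segment (pos w) (pos z)"
      by (simp add: img)
    then have "pos w \<in> pos ` ({u, v} \<inter> {w, z})"
      using meet[OF uv wz] w by blast
    then show False
      using inj w P.in_arcsD1[OF uv] P.in_arcsD2[OF uv] by (auto simp: inj_on_def)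
  qed
  have "plane_drawing G pos curve"
    unfolding plane_drawing_def using inj arcs avoid meet
    by (simp add: img case_prod_unfold)
  then show ?thesis unfolding planar_graph_def by blast
qed

text \<open>
  Homogeneous coordinates allow points at infinity such as \<open>(1, 0, 0)\<close> and \<open>(0, 1, 0)\<close>, and turn
  questions about the position of points and lines into signs of integers. The chart divides by
  \<open>x + y + w\<close> instead of \<open>w\<close>. It is the projective map that takes \<open>(x, y)\<close> to
  \<open>(x, y) / (1 + x + y)\<close> and the two points at infinity to the complex numbers 1 and \<open>i\<close>.
\<close>

type_synonym hpoint = "int \<times> int \<times> int"

definition weight :: "hpoint \<Rightarrow> int" where
  "weight = (\<lambda>(x, y, w). x + y + w)"

definition chart :: "hpoint \<Rightarrow> complex" where
  "chart P = (case P of (x, y, w) \<Rightarrow> Complex (x / weight P) (y / weight P))"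

text \<open>
  A line is given by a linear form that vanishes on it; \<open>join P Q\<close> is the cross product, so that
  \<open>form (join P Q) R\<close> is the determinant of \<open>P\<close>, \<open>Q\<close>, \<open>R\<close>, the orientation of the three points.
\<close>

definition form :: "hpoint \<Rightarrow> hpoint \<Rightarrow> int" where
  "form = (\<lambda>(a, b, c) (x, y, w). a * x + b * y + c * w)"

definition join :: "hpoint \<Rightarrow> hpoint \<Rightarrow> hpoint" where
  "join = (\<lambda>(x, y, w) (x', y', w'). (y * w' - w * y', w * x' - x * w', x * y' - y * x'))"

text \<open>
  The affine function on the plane into which the chart turns a form. By \<open>form_at_chart\<close> it has the
  sign of the form at every point of positive weight.
\<close>

definition form_at :: "hpoint \<Rightarrow> complex \<Rightarrow> real" where
  "form_at = (\<lambda>(a, b, c) z. a * Re z + b * Im z + c * (1 - Re z - Im z))"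

lemma form_at_chart:
  assumes "weight P > 0"
  shows "form_at l (chart P) = form l P / weight P"
proof -
  obtain a b c where l: "l = (a, b, c)" by (cases l)
  obtain x y w where P: "P = (x, y, w)" by (cases P)
  have "x / weight P + y / weight P + w / weight P = (x + y + w) / weight P"
    by (simp add: add_divide_distrib)
  also have "\<dots> = 1" using assms by (simp add: weight_def P)
  finally have "1 - x / weight P - y / weight P = w / weight P"
    by linarith
  then show ?thesis
    by (simp add: l form_at_def form_def P chart_def add_divide_distrib)
qed

lemma form_at_segment:
  "form_at l ((1 - t) *\<^sub>R p + t *\<^sub>R q) = (1 - t) * form_at l p + t * form_at l q"
  by (cases l) (simp add: form_at_def algebra_simps)

lemma form_join: "form (join P Q) P = 0" "form (join P Q) Q = 0"
  by (cases P; cases Q; simp add: form_def join_def algebra_simps)+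

lemma form_join_swap: "form (join Q P) R = - form (join P Q) R"
  by (cases P; cases Q; cases R) (simp add: form_def join_def algebra_simps)

lemma segment_form_nonpos:
  assumes "form l P \<le> 0" "form l Q \<le> 0" "weight P > 0" "weight Q > 0"
    "p \<in> closed_segment (chart P) (chart Q)"
  shows "form_at l p \<le> 0"
proof -
  obtain t where t: "0 \<le> t" "t \<le> 1" and p: "p = (1 - t) *\<^sub>R chart P + t *\<^sub>R chart Q"
    using assms(5) by (auto simp: closed_segment_def)
  have "form_at l (chart P) \<le> 0" "form_at l (chart Q) \<le> 0"
    using assms by (simp_all add: form_at_chart divide_nonpos_pos)
  then show ?thesis
    unfolding p form_at_segment using t by (simp add: mult_nonneg_nonpos add_nonpos_nonpos)
qed

lemma segment_form_pos:
  assumes "form l P > 0" "form l Q > 0" "weight P > 0" "weight Q > 0"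
    "p \<in> closed_segment (chart P) (chart Q)"
  shows "form_at l p > 0"
proof -
  obtain t where t: "0 \<le> t" "t \<le> 1" and p: "p = (1 - t) *\<^sub>R chart P + t *\<^sub>R chart Q"
    using assms(5) by (auto simp: closed_segment_def)
  have *: "form_at l (chart P) > 0" "form_at l (chart Q) > 0"
    using assms by (simp_all add: form_at_chart)
  show ?thesis
  proof (cases "t = 1")
    case True
    then show ?thesis using * by (simp add: p)
  next
    case False
    then show ?thesis
      unfolding p form_at_segment using t * by (intro add_pos_nonneg) auto
  qed
qed

lemma segments_disjoint:
  assumes "weight P > 0" "weight Q > 0" "weight R > 0" "weight S > 0"
    and "form l P \<le> 0" "form l Q \<le> 0" "form l R > 0" "form l S > 0"
  shows "closed_segment (chart P) (chart Q) \<inter> closed_segment (chart R) (chart S) = {}"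
  using segment_form_nonpos[of l P Q] segment_form_pos[of l R S] assms by fastforce

lemma form_uminus: "form (- a, - b, - c) P = - form (a, b, c) P"
  by (cases P) (simp add: form_def)

definition same_side :: "hpoint \<Rightarrow> hpoint \<Rightarrow> hpoint \<Rightarrow> hpoint \<Rightarrow> bool" where
  "same_side P Q R S \<longleftrightarrow>
    (let l = join P Q; a = form l R; b = form l S in 0 < a \<and> 0 < b \<or> a < 0 \<and> b < 0)"

lemma same_side_swap: "same_side Q P R S = same_side P Q R S" "same_side P Q S R = same_side P Q R S"
  by (auto simp: same_side_def Let_def form_join_swap[of Q P])

lemma segments_disjoint_same_side:
  assumes "weight P > 0" "weight Q > 0" "weight R > 0" "weight S > 0" and same: "same_side P Q R S"
  shows "closed_segment (chart P) (chart Q) \<inter> closed_segment (chart R) (chart S) = {}"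
proof -
  obtain a b c where l: "join P Q = (a, b, c)" by (cases "join P Q")
  note join = form_join[of P Q, unfolded l]
  from same have "0 < form (join P Q) R \<and> 0 < form (join P Q) S \<or>
      form (join P Q) R < 0 \<and> form (join P Q) S < 0"
    by (simp add: same_side_def Let_def)
  then show ?thesis
  proof
    assume "0 < form (join P Q) R \<and> 0 < form (join P Q) S"
    then show ?thesis
      using assms(1-4) join by (intro segments_disjoint[of _ _ _ _ "(a, b, c)"]) (simp_all add: l)
  next
    assume "form (join P Q) R < 0 \<and> form (join P Q) S < 0"
    then show ?thesis
      using assms(1-4) join
      by (intro segments_disjoint[of _ _ _ _ "(- a, - b, - c)"]) (simp_all add: l form_uminus)
  qed
qed

text \<open>
  The line through the first segment meets the second one only in its end \<open>P\<close>, since the form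
  varies linearly along the second segment and is not zero at \<open>S\<close>.
\<close>

lemma segments_share_end:
  assumes "weight P > 0" "weight Q > 0" "weight S > 0" "form (join P Q) S \<noteq> 0"
  shows "closed_segment (chart P) (chart Q) \<inter> closed_segment (chart P) (chart S) \<subseteq> {chart P}"
proof
  fix p assume p: "p \<in> closed_segment (chart P) (chart Q) \<inter> closed_segment (chart P) (chart S)"
  obtain s where s: "p = (1 - s) *\<^sub>R chart P + s *\<^sub>R chart Q"
    using IntD1[OF p] by (auto simp: closed_segment_def)
  obtain t where t: "p = (1 - t) *\<^sub>R chart P + t *\<^sub>R chart S"
    using IntD2[OF p] by (auto simp: closed_segment_def)
  have "form_at (join P Q) p = 0"
    unfolding s form_at_segment using assms by (simp add: form_at_chart form_join)
  then have "t * form_at (join P Q) (chart S) = 0"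
    unfolding t form_at_segment using assms by (simp add: form_at_chart form_join)
  then have "t = 0" using assms by (simp add: form_at_chart)
  then show "p \<in> {chart P}" by (simp add: t)
qed

section \<open>The drawing\<close>

text \<open>
  A drawing of the gadget inside a square of side 13 for which every edge to hub 25 can be drawn
  as a horizontal ray to the right, and every edge to hub 26 as a vertical ray upwards.
\<close>

definition coords :: "(int \<times> int) list" where
  "coords = [(1, 2), (2, 4), (5, 3), (3, 1), (7, 4), (7, 3), (4, 2), (6, 4), (4, 5), (8, 4), (5, 5),
    (6, 7), (4, 4), (6, 8), (3, 6), (4, 8), (2, 7), (4, 9), (5, 8), (3, 7), (6, 9), (7, 9),
    (4, 10), (6, 11), (5, 12)]"

text \<open>
  The copies are translates along the diagonal. Translations fix the points at infinity, so all of
  them lead to the same hubs.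
\<close>

definition place :: "int \<Rightarrow> nat \<Rightarrow> hpoint" where
  "place d i = (if i = 25 then (1, 0, 0) else if i = 26 then (0, 1, 0)
     else (fst (coords ! i) + d, snd (coords ! i) + d, 1))"

lemma coords_bounds:
  assumes "i < 25"
  shows "0 < fst (coords ! i)" "0 < snd (coords ! i)" "fst (coords ! i) < 13" "snd (coords ! i) < 13"
proof -
  have "\<forall>i\<in>set [0..<25]. 0 < fst (coords ! i) \<and> 0 < snd (coords ! i) \<and>
      fst (coords ! i) < 13 \<and> snd (coords ! i) < 13"
    by code_simp
  then show "0 < fst (coords ! i)" "0 < snd (coords ! i)" "fst (coords ! i) < 13" "snd (coords ! i) < 13"
    using assms by auto
qed

lemma coords_inj:
  assumes "i < 25" "j < 25" "coords ! i = coords ! j"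
  shows "i = j"
proof -
  have "distinct coords" "length coords = 25" by code_simp+
  then show ?thesis using assms nth_eq_iff_index_eq by metis
qed

text \<open>
  A translation is a linear map of determinant 1 on homogeneous coordinates.
\<close>

lemma form_join_translate:
  "form (join (place d i) (place d j)) (place d k) = form (join (place 0 i) (place 0 j)) (place 0 k)"
  by (simp add: place_def join_def form_def algebra_simps)

lemma gadget_star:
  assumes "(i, j) \<in> gadget" "(i, k) \<in> gadget" "j \<noteq> k"
  shows "form (join (place 0 i) (place 0 j)) (place 0 k) \<noteq> 0"
proof -
  have "\<forall>i\<in>set [0..<27]. \<forall>j\<in>set (gadget_nbrs ! i). \<forall>k\<in>set (gadget_nbrs ! i).
      j = k \<or> form (join (place 0 i) (place 0 j)) (place 0 k) \<noteq> 0"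
    by code_simp
  from gadget_all[OF this assms(1)] show ?thesis
    using assms(2,3) unfolding gadget_def by blast
qed

text \<open>
  The points are stored with the edge so that they are looked up once per edge and not once per
  pair of edges.
\<close>

definition gadget_edges :: "(nat \<times> nat \<times> hpoint \<times> hpoint) list" where
  "gadget_edges = [(i, j, place 0 i, place 0 j). i \<leftarrow> [0..<27], j \<leftarrow> gadget_nbrs ! i, i < j]"

lemma gadget_edges_apart:
  "list_all (\<lambda>(i, j, P, Q). list_all (\<lambda>(k, l, R, S).
      i = k \<or> i = l \<or> j = k \<or> j = l \<or> same_side P Q R S \<or> same_side R S P Q) gadget_edges) gadget_edges"
  by code_simp

lemma gadget_apart:
  assumes arcs: "(i, j) \<in> gadget" "(k, l) \<in> gadget" and disj: "{i, j} \<inter> {k, l} = {}"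
  shows "same_side (place d i) (place d j) (place d k) (place d l) \<or>
    same_side (place d k) (place d l) (place d i) (place d j)"
proof -
  let ?side = "\<lambda>i j k l. same_side (place 0 i) (place 0 j) (place 0 k) (place 0 l)"
  have sorted: "?side i j k l \<or> ?side k l i j"
    if "(i, j) \<in> gadget" "(k, l) \<in> gadget" "i < j" "k < l" "{i, j} \<inter> {k, l} = {}" for i j k l
  proof -
    have "(i, j, place 0 i, place 0 j) \<in> set gadget_edges" "(k, l, place 0 k, place 0 l) \<in> set gadget_edges"
      using that(1-4) by (auto simp: gadget_edges_def gadget_def)
    then show ?thesis
      using gadget_edges_apart that(5) unfolding list_all_iff by fastforce
  qed
  have "i \<noteq> j" "k \<noteq> l" using gadget_arc(1)[OF arcs(1)] gadget_arc(1)[OF arcs(2)] by auto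
  then have "?side i j k l \<or> ?side k l i j"
    using sorted[of i j k l] sorted[of j i k l] sorted[of i j l k] sorted[of j i l k] assms
      gadget_sym[OF arcs(1)] gadget_sym[OF arcs(2)]
    by (cases "i < j"; cases "k < l") (auto simp: same_side_swap insert_commute)
  then show ?thesis
    by (simp add: same_side_def Let_def form_join_translate[of d])
qed

lemma chart_eqD:
  assumes "chart P = chart Q" "weight P > 0" "weight Q > 0"
  shows "form l P * weight Q = form l Q * weight P"
proof -
  have "form l P / weight P = form l Q / weight Q"
    using assms by (metis form_at_chart)
  then have "real_of_int (form l P) * weight Q = form l Q * weight P"
    using assms(2,3) by (simp add: frac_eq_eq)
  then have "real_of_int (form l P * weight Q) = real_of_int (form l Q * weight P)"
    by simp
  then show ?thesis by (simp only: of_int_eq_iff)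
qed

definition position :: "nat \<Rightarrow> complex" where
  "position x = chart (place (13 * int (x div 25)) (local_index x))"

lemma position_copy_vertex: "k < 9 \<Longrightarrow> i < 27 \<Longrightarrow> position (copy_vertex k i) = chart (place (13 * int k) i)"
  by (auto simp: position_def local_index_copy_vertex) (auto simp: copy_vertex_def place_def)

lemma weight_place: "0 \<le> d \<Longrightarrow> i < 27 \<Longrightarrow> 0 < weight (place d i)"
  using coords_bounds[of i] by (auto simp: weight_def place_def)

lemma place_inj:
  assumes eq: "chart (place (13 * int k) i) = chart (place (13 * int k') j)" and "i < 27" "j < 27"
  shows "i = j \<and> (i < 25 \<longrightarrow> k = k')"
proof -
  let ?P = "place (13 * int k) i" and ?Q = "place (13 * int k') j"
  have w: "weight ?P > 0" "weight ?Q > 0" using assms by (simp_all add: weight_place)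
  note f = chart_eqD[OF eq w]
  have fx: "fst ?P * weight ?Q = fst ?Q * weight ?P" using f[of "(1, 0, 0)"]
    by (simp add: form_def split: prod.splits)
  have fy: "fst (snd ?P) * weight ?Q = fst (snd ?Q) * weight ?P" using f[of "(0, 1, 0)"]
    by (simp add: form_def split: prod.splits)
  have fw: "snd (snd ?P) * weight ?Q = snd (snd ?Q) * weight ?P" using f[of "(0, 0, 1)"]
    by (simp add: form_def split: prod.splits)
  show ?thesis
  proof (cases "i < 25 \<and> j < 25")
    case True
    then have "weight ?P = weight ?Q" using fw by (simp add: place_def)
    then have "fst ?P = fst ?Q" "fst (snd ?P) = fst (snd ?Q)" using fx fy w by auto
    then have xy: "fst (coords ! i) + 13 * int k = fst (coords ! j) + 13 * int k'"
      "snd (coords ! i) + 13 * int k = snd (coords ! j) + 13 * int k'"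
      using True by (simp_all add: place_def)
    then have "k = k'" using coords_bounds[of i] coords_bounds[of j] True by linarith
    moreover from this have "coords ! i = coords ! j" using xy by (simp add: prod_eq_iff)
    ultimately show ?thesis using coords_inj True by blast
  next
    case False
    then show ?thesis
      using fx fy fw w assms(2,3) by (auto simp: place_def weight_def split: if_splits)
  qed
qed

lemma position_inj: "inj_on position (pverts glued)"
proof (rule inj_onI)
  fix x y assume "x \<in> pverts glued" "y \<in> pverts glued" and eq: "position x = position y"
  then have xy: "x < 227" "y < 227" by (simp_all add: glued_def)
  have less: "local_index z < 27" if "z < 227" for z
    using that by (auto simp: local_index_def intro: less_trans[of _ 25])
  note eq' = place_inj[OF eq[unfolded position_def] less[OF xy(1)] less[OF xy(2)]]
  show "x = y"
  proof (rule local_index_inj)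
    show "local_index x = local_index y" using eq' ..
    show "x div 25 = y div 25" if "x < 225" using eq' that local_index_hub(3)[of x] by blast
  qed (fact xy)+
qed

text \<open>
  Rays from different copies to the same hub lie on different parallels, because the squares of
  the copies share neither a row nor a column.
\<close>

lemma place_star_hub:
  assumes "i = 25 \<or> i = 26" "j < 25" "j' < 25" "k \<noteq> k'"
  shows "form (join (place (13 * int k) i) (place (13 * int k) j)) (place (13 * int k') j') \<noteq> 0"
proof -
  have "13 * int k + 13 \<le> 13 * int k' \<or> 13 * int k' + 13 \<le> 13 * int k" using assms(4) by linarith
  then show ?thesis
    using assms(1-3) coords_bounds[of j] coords_bounds[of j']
    by (auto simp: place_def join_def form_def)
qed

lemma glued_star:
  assumes "(x, y) \<in> parcs glued" "(x, z) \<in> parcs glued" "y \<noteq> z"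
  shows "closed_segment (position x) (position y) \<inter> closed_segment (position x) (position z)
    \<subseteq> {position x}"
proof -
  obtain k i j where k: "k < 9" and ij: "(i, j) \<in> gadget"
    and x: "x = copy_vertex k i" and y: "y = copy_vertex k j"
    using assms(1) by (rule glued_arcE)
  obtain k' i' j' where k': "k' < 9" and ij': "(i', j') \<in> gadget"
    and x': "x = copy_vertex k' i'" and z: "z = copy_vertex k' j'"
    using assms(2) by (rule glued_arcE)
  have i: "i' = i" "i < 25 \<Longrightarrow> k' = k"
    using x x' k k' by (simp_all add: copy_vertex_eq_iff)
  have less: "i < 27" "j < 27" "j' < 27"
    using gadget_less ij ij' by blast+
  have "form (join (place (13 * int k) i) (place (13 * int k) j)) (place (13 * int k') j') \<noteq> 0"
  proof (cases "k = k'")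
    case True
    then show ?thesis
      using gadget_star[OF ij, of j'] ij' assms(3)
      by (auto simp: form_join_translate[of "13 * int k'"] True i y z)
  next
    case False
    then have "i = 25 \<or> i = 26" using i less by linarith
    moreover have "j < 25" "j' < 25" using calculation gadget_arc(2)[OF ij] gadget_arc(2)[OF ij'] i by auto
    ultimately show ?thesis using False by (rule place_star_hub)
  qed
  then have "closed_segment (chart (place (13 * int k) i)) (chart (place (13 * int k) j)) \<inter>
      closed_segment (chart (place (13 * int k) i)) (chart (place (13 * int k') j'))
      \<subseteq> {chart (place (13 * int k) i)}"
    by (intro segments_share_end) (simp_all add: weight_place less)
  moreover have "position x = chart (place (13 * int k) i)" "position y = chart (place (13 * int k) j)"
     "position z = chart (place (13 * int k') j')"
    by (simp_all add: x y z position_copy_vertex k k' less)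
  ultimately show ?thesis by simp
qed

text \<open>
  The corner \<open>(c, c)\<close> above the square of copy \<open>k\<close> separates it from all later squares, which lie
  to the right of and above that corner. The separating line through the corner depends on the edge
  of copy \<open>k\<close>: horizontal for an edge to the right-hand hub, vertical for an edge to the upper hub,
  and of slope -1 for an edge between inner vertices. The hub at which an edge of copy \<open>k\<close> ends lies
  on the line chosen for it, and any other hub lies strictly on the far side.
\<close>

lemma copies_apart:
  assumes "k < k'" "(i, j) \<in> gadget" "(i', j') \<in> gadget" "{i, j} \<inter> {i', j'} \<subseteq> {..<25}"
  shows "closed_segment (chart (place (13 * int k) i)) (chart (place (13 * int k) j)) \<inter>
    closed_segment (chart (place (13 * int k') i')) (chart (place (13 * int k') j')) = {}"
proof -
  define c where "c = 13 * int k + 13"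
  have c: "c \<le> 13 * int k'" using assms(1) by (simp add: c_def)
  have less: "i < 27" "j < 27" "i' < 27" "j' < 27"
    using gadget_less assms(2,3) by blast+
  define l :: hpoint where
    "l = (if 25 \<in> {i, j} then (0, 1, - c) else if 26 \<in> {i, j} then (1, 0, - c) else (1, 1, - 2 * c))"
  have before: "form l (place (13 * int k) m) \<le> 0" if m: "m \<in> {i, j}" for m
  proof -
    consider "m < 25" | "m = 25" | "m = 26" using m less by force
    then show ?thesis
    proof cases
      case 1
      then have "fst (coords ! m) + 13 * int k < c" "snd (coords ! m) + 13 * int k < c"
        using coords_bounds[of m] by (simp_all add: c_def)
      then show ?thesis using 1 by (simp add: l_def form_def place_def)
    next
      case 2
      then have "25 \<in> {i, j}" using m by simp
      then show ?thesis unfolding 2 by (simp add: l_def form_def place_def)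
    next
      case 3
      then have "26 \<in> {i, j}" "25 \<notin> {i, j}" using m gadget_arc(2)[OF assms(2)] by auto
      then show ?thesis unfolding 3 l_def by (simp only: if_True if_False) (simp add: form_def place_def)
    qed
  qed
  have after: "form l (place (13 * int k') m) > 0" if m: "m \<in> {i', j'}" for m
  proof -
    consider "m < 25" | "m = 25" | "m = 26" using m less by force
    then show ?thesis
    proof cases
      case 1
      then have "c < fst (coords ! m) + 13 * int k'" "c < snd (coords ! m) + 13 * int k'"
        using coords_bounds[of m] c by linarith+
      then show ?thesis using 1 by (simp add: l_def form_def place_def)
    next
      case 2
      then have "25 \<notin> {i, j}" using m assms(4) by auto
      then show ?thesis unfolding 2 l_def by (simp only: if_False) (simp add: form_def place_def)
    next
      case 3
      then have "26 \<notin> {i, j}" using m assms(4) by auto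
      then show ?thesis unfolding 3 l_def by (simp only: if_False) (simp add: form_def place_def)
    qed
  qed
  show ?thesis
    using before after less by (intro segments_disjoint[of _ _ _ _ l]) (simp_all add: weight_place)
qed

lemma glued_apart:
  assumes "(x, y) \<in> parcs glued" "(x', y') \<in> parcs glued" "{x, y} \<inter> {x', y'} = {}"
  shows "closed_segment (position x) (position y) \<inter> closed_segment (position x') (position y') = {}"
proof -
  obtain k i j where k: "k < 9" and ij: "(i, j) \<in> gadget"
    and x: "x = copy_vertex k i" and y: "y = copy_vertex k j"
    using assms(1) by (rule glued_arcE)
  obtain k' i' j' where k': "k' < 9" and ij': "(i', j') \<in> gadget"
    and x': "x' = copy_vertex k' i'" and y': "y' = copy_vertex k' j'"
    using assms(2) by (rule glued_arcE)
  have less: "i < 27" "j < 27" "i' < 27" "j' < 27"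
    using gadget_less ij ij' by blast+
  have hubs: "{i, j} \<inter> {i', j'} \<subseteq> {..<25}"
  proof
    fix m assume m: "m \<in> {i, j} \<inter> {i', j'}"
    then have "copy_vertex k m \<in> {x, y}" "copy_vertex k' m \<in> {x', y'}" by (auto simp: x y x' y')
    then have "copy_vertex k m \<noteq> copy_vertex k' m" using assms(3) by auto
    then show "m \<in> {..<25}" by (auto simp: copy_vertex_def split: if_splits)
  qed
  consider "k = k'" | "k < k'" | "k' < k" by linarith
  then have "closed_segment (chart (place (13 * int k) i)) (chart (place (13 * int k) j)) \<inter>
    closed_segment (chart (place (13 * int k') i')) (chart (place (13 * int k') j')) = {}"
  proof cases
    case 1
    have "{i, j} \<inter> {i', j'} = {}" using assms(3) unfolding x y x' y' 1 by auto
    from gadget_apart[OF ij ij' this] show ?thesis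
    proof
      assume "same_side (place (13 * int k) i) (place (13 * int k) j)
        (place (13 * int k) i') (place (13 * int k) j')"
      then show ?thesis
        using less by (intro segments_disjoint_same_side) (simp_all add: weight_place 1)
    next
      assume "same_side (place (13 * int k) i') (place (13 * int k) j')
        (place (13 * int k) i) (place (13 * int k) j)"
      then show ?thesis
        using less by (subst Int_commute, intro segments_disjoint_same_side) (simp_all add: weight_place 1)
    qed
  next
    case 2
    then show ?thesis using ij ij' hubs by (rule copies_apart)
  next
    case 3
    then show ?thesis using copies_apart[OF 3 ij' ij] hubs by (simp add: Int_commute)
  qed
  then show ?thesis by (simp add: x y x' y' position_copy_vertex k k' less)
qed

lemma glued_meet:
  assumes "(x, y) \<in> parcs glued" "(x', y') \<in> parcs glued" "{x, y} \<noteq> {x', y'}"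
  shows "closed_segment (position x) (position y) \<inter> closed_segment (position x') (position y')
    \<subseteq> position ` ({x, y} \<inter> {x', y'})"
proof (cases "{x, y} \<inter> {x', y'} = {}")
  case True
  from glued_apart[OF assms(1,2) this] show ?thesis by simp
next
  case False
  have star: ?thesis if "(u, v) \<in> parcs glued" "(u, v') \<in> parcs glued" "{x, y} = {u, v}" "{x', y'} = {u, v'}" for u v v'
  proof -
    have "v \<noteq> v'" using assms(3) that by auto
    note s = glued_star[OF that(1,2) this]
    have segs: "closed_segment (position x) (position y) = closed_segment (position u) (position v)"
      "closed_segment (position x') (position y') = closed_segment (position u) (position v')"
      using that(3,4) by (auto simp: doubleton_eq_iff closed_segment_commute)
    have "u \<in> {x, y} \<inter> {x', y'}" unfolding that(3,4) by simp
    then have "position u \<in> position ` ({x, y} \<inter> {x', y'})" by (rule imageI)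
    with s show ?thesis unfolding segs by blast
  qed
  from False consider "x = x'" | "x = y'" | "y = x'" | "y = y'" by auto
  then show ?thesis
  proof cases
    case 1 then show ?thesis using assms by (intro star[of x y y']) auto
  next
    case 2 then show ?thesis using assms glued_sym[OF assms(2)] by (intro star[of x y x']) auto
  next
    case 3 then show ?thesis using assms glued_sym[OF assms(1)] by (intro star[of y x y']) auto
  next
    case 4 then show ?thesis using glued_sym[OF assms(1)] glued_sym[OF assms(2)] by (intro star[of y x x']) auto
  qed
qed

lemma glued_planar: "planar_graph glued"
proof (rule planar_graph_straight_line[OF glued_pair_graph position_inj _ glued_meet])
  fix w assume "w \<in> pverts glued"
  then have w: "w < 227" by (simp add: glued_def)
  have "\<forall>i\<in>set [0..<27]. hd (gadget_nbrs ! i) \<in> set (gadget_nbrs ! i)" by code_simp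
  moreover have "local_index w < 27"
    using w by (auto simp: local_index_def intro: less_trans[of _ 25])
  ultimately have "(local_index w, hd (gadget_nbrs ! local_index w)) \<in> gadget" by (simp add: gadget_def)
  moreover obtain k where "k < 9" "copy_vertex k (local_index w) = w"
  proof (cases "w < 225")
    case True
    then show ?thesis using copy_vertex_local_index(1)[OF True] by (intro that[of "w div 25"]) simp_all
  next
    case False
    then show ?thesis using copy_vertex_local_index(2)[of w 0] by (intro that[of 0]) simp_all
  qed
  ultimately show "\<exists>z. (w, z) \<in> parcs glued" using glued_arcI by fastforce
qed

section \<open>A graph that is not (3,2)-choosable\<close>

theorem mainTheorem4:
  shows "\<exists>G :: nat pair_pre_digraph.
           pair_graph G \<and> planar_graph G \<and>
           \<not> has_cycle_of_length G 4 \<and> \<not> has_cycle_of_length G 5 \<and>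
           \<not> choosable 3 2 G"
  using glued_pair_graph glued_planar glued_no_4 glued_no_5 glued_not_choosable by blast

end
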